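(* Let $\mathcal A$ and $\mathfrak A$ be Banach algebras such that $\mathcal A$ is a Banach $\mathfrak A$-bimodule with compatible actions. Let $D:\mathcal A\rtimes\mathfrak A\to(\mathcal A\rtimes\mathfrak A)^{(1)}$ be a cyclic derivation, with components $D^1_{\mathcal A}:\mathcal A\to\mathcal A^{(1)}$, $D^2_{\mathcal A}:\mathcal A\to\mathfrak A^{(1)}$, $D^1_{\mathfrak A}:\mathfrak A\to\mathcal A^{(1)}$, $D^2_{\mathfrak A}:\mathfrak A\to\mathfrak A^{(1)}$ determined by $D((a,\beta))=(D^1_{\mathcal A}(a)+D^1_{\mathfrak A}(\beta),\ D^2_{\mathcal A}(a)+D^2_{\mathfrak A}(\beta))$. If $a^{(1)}\in\mathcal A^{(1)}$ and $\beta^{(1)}\in\mathfrak A^{(1)}$, then $D=\mathrm{ad}_{(a^{(1)},\beta^{(1)})}$ if and only if $D^1_{\mathcal A}=\mathrm{ad}_{a^{(1)}}$ (on $\mathcal A$), $D^2_{\mathfrak A}=\mathrm{ad}_{\beta^{(1)}}$, $D^1_{\mathfrak A}=\mathrm{ad}_{a^{(1)}}$ (on $\mathfrak A$) and $D^2_{\mathcal A}(a)=a\blacktriangle a^{(1)}-a^{(1)}\bullet a$ for all $a\in\mathcal A$.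
   Context: The actions of $\mathfrak A$ on $\mathcal A$ are compatible if for all $a,b\in\mathcal A$ and $\beta\in\mathfrak A$: $\beta\cdot(ab)=(\beta\cdot a)b$, $(ab)\cdot\beta=a(b\cdot\beta)$, $a(\beta\cdot b)=(a\cdot\beta)b$. The amalgamated duplication $\mathcal A\rtimes\mathfrak A$ is $\mathcal A\times\mathfrak A$ with product $(a,\beta)(b,\gamma)=(ab+a\cdot\gamma+\beta\cdot b,\ \beta\gamma)$ and norm $\|(a,\beta)\|=\|a\|+\|\beta\|$. $\mathcal Y^{(1)}$ is the dual of $\mathcal Y$; $(\mathcal A\rtimes\mathfrak A)^{(1)}$ is identified with $\mathcal A^{(1)}\times\mathfrak A^{(1)}$ via $\langle(a^{(1)},\beta^{(1)}),(a,\beta)\rangle=\langle a^{(1)},a\rangle+\langle\beta^{(1)},\beta\rangle$. For $a\in\mathcal A$ and $x\in\mathcal A^{(1)}$, the elements $a\blacktriangle x,\ x\bullet a\in\mathfrak A^{(1)}$ are given by $\langle a\blacktriangle x,\gamma\rangle=\langle x,\gamma\cdot a\rangle$, $\langle x\bullet a,\gamma\rangle=\langle x,a\cdot\gamma\rangle$ for $\gamma\in\mathfrak A$. A derivation from a Banach algebra $\mathcal C$ into a Banach $\mathcal C$-bimodule $\mathcal X$ is a continuous linear map $D$ with $D(c_1c_2)=D(c_1)\cdot c_2+c_1\cdot D(c_2)$; for $x\in\mathcal X$, $\mathrm{ad}_x(c)=c\cdot x-x\cdot c$. Duals carry the usual dual bimodule structure ($\langle f\cdot c,x\rangle=\langle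 f,c\cdot x\rangle$, $\langle c\cdot f,x\rangle=\langle f,x\cdot c\rangle$); $\mathcal A^{(1)}$ is both an $\mathcal A$-bimodule and an $\mathfrak A$-bimodule, and $\mathrm{ad}_{a^{(1)}}$ on $\mathcal A$ (resp. on $\mathfrak A$) uses the former (resp. latter). A derivation $D:\mathcal C\to\mathcal C^{(1)}$ is cyclic if $\langle D(c_1),c_2\rangle+\langle D(c_2),c_1\rangle=0$ for all $c_1,c_2\in\mathcal C$. *)

theory Defs
  imports "HOL-Analysis.Analysis"
begin

text \<open>Banach algebras are complex and not assumed to be unital.  The classes add a complex
  scalar multiplication to the corresponding real classes.\<close>

class complex_normed_vector = real_normed_vector +
  fixes scaleC :: "complex \<Rightarrow> 'a \<Rightarrow> 'a"  (infixr "*\<^sub>C" 75)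
  assumes scaleC_add_right: "c *\<^sub>C (x + y) = c *\<^sub>C x + c *\<^sub>C y"
    and scaleC_add_left: "(c + d) *\<^sub>C x = c *\<^sub>C x + d *\<^sub>C x"
    and scaleC_scaleC: "c *\<^sub>C (d *\<^sub>C x) = (c * d) *\<^sub>C x"
    and scaleR_scaleC: "r *\<^sub>R x = complex_of_real r *\<^sub>C x"
    and norm_scaleC: "norm (c *\<^sub>C x) = norm c * norm x"

class complex_banach = complex_normed_vector + banach

class complex_banach_algebra = complex_banach + real_normed_algebra +
  assumes mult_scaleC_left: "(c *\<^sub>C x) * y = c *\<^sub>C (x * y)"
    and mult_scaleC_right: "x * (c *\<^sub>C y) = c *\<^sub>C (x * y)"

instantiation complex :: complex_banach_algebra
begin

definition "c *\<^sub>C (z :: complex) = c * z"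

instance
  by standard (auto simp: scaleC_complex_def algebra_simps norm_mult scaleR_conv_of_real)

end

lemma scaleC_zero_right [simp]: "c *\<^sub>C (0 :: 'a :: complex_normed_vector) = 0"
  using scaleC_add_right[of c 0 0] by simp

lemma scaleC_minus_right: "c *\<^sub>C (- x) = - (c *\<^sub>C (x :: 'a :: complex_normed_vector))"
  using scaleC_add_right[of c x "- x"] by (simp add: eq_neg_iff_add_eq_0 add.commute)

lemma scaleC_diff_right:
  "c *\<^sub>C (x - y) = c *\<^sub>C x - c *\<^sub>C (y :: 'a :: complex_normed_vector)"
  using scaleC_add_right[of c x "- y"] by (simp add: scaleC_minus_right)

definition bounded_clinear ::
    "('a :: complex_normed_vector \<Rightarrow> 'b :: complex_normed_vector) \<Rightarrow> bool"
  where "bounded_clinear f \<longleftrightarrow> bounded_linear f \<and> (\<forall>c x. f (c *\<^sub>C x) = c *\<^sub>C f x)"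

definition bounded_cbilinear ::
    "('a :: complex_normed_vector \<Rightarrow> 'b :: complex_normed_vector
      \<Rightarrow> 'c :: complex_normed_vector) \<Rightarrow> bool"
  where "bounded_cbilinear p \<longleftrightarrow> bounded_bilinear p \<and>
    (\<forall>c x y. p (c *\<^sub>C x) y = c *\<^sub>C p x y \<and> p x (c *\<^sub>C y) = c *\<^sub>C p x y)"

lemma bounded_cbilinear_left: "bounded_cbilinear p \<Longrightarrow> bounded_clinear (\<lambda>x. p x y)"
  by (simp add: bounded_cbilinear_def bounded_clinear_def bounded_bilinear.bounded_linear_left)

lemma bounded_cbilinear_right: "bounded_cbilinear p \<Longrightarrow> bounded_clinear (p x)"
  by (simp add: bounded_cbilinear_def bounded_clinear_def bounded_bilinear.bounded_linear_right)

lemma bounded_cbilinear_times: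
  "bounded_cbilinear ((*) :: 'a :: complex_banach_algebra \<Rightarrow> 'a \<Rightarrow> 'a)"
  by (simp add: bounded_cbilinear_def bounded_bilinear_mult mult_scaleC_left mult_scaleC_right)

text \<open>The norm is inherited from the bounded real-linear maps; it is the operator norm.\<close>

typedef (overloaded) 'a dual =
  "{f :: 'a :: complex_normed_vector \<Rightarrow>\<^sub>L complex. bounded_clinear (blinfun_apply f)}"
  by (rule exI[of _ 0])
    (simp add: bounded_clinear_def zero_blinfun.rep_eq scaleC_complex_def)

definition pairing :: "'a :: complex_normed_vector dual \<Rightarrow> 'a \<Rightarrow> complex"
  where "pairing f = blinfun_apply (Rep_dual f)"

definition dual_of :: "('a :: complex_normed_vector \<Rightarrow> complex) \<Rightarrow> 'a dual"
  where "dual_of g = (THE f. pairing f = g)"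

lemma pairing_bounded_clinear: "bounded_clinear (pairing f)"
  using Rep_dual[of f] by (simp add: pairing_def)

lemma dual_eqI: "(\<And>x. pairing f x = pairing g x) \<Longrightarrow> f = g"
  by (metis Rep_dual_inject blinfun_eqI pairing_def)

lemma pairing_dual_of:
  assumes "bounded_clinear g"
  shows "pairing (dual_of g) = g"
proof -
  have "blinfun_apply (Blinfun g) = g"
    using assms by (simp add: bounded_clinear_def bounded_linear_Blinfun_apply)
  then have "pairing (Abs_dual (Blinfun g)) = g"
    using assms by (simp add: pairing_def Abs_dual_inverse)
  then show ?thesis
    unfolding dual_of_def by (rule theI) (metis dual_eqI \<open>pairing (Abs_dual (Blinfun g)) = g\<close>)
qed

lemma
  shows pairing_add: "pairing f (x + y) = pairing f x + pairing f y"
    and pairing_diff: "pairing f (x - y) = pairing f x - pairing f y"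
    and pairing_zero: "pairing f 0 = 0"
    and pairing_scaleC: "pairing f (c *\<^sub>C x) = c * pairing f x"
    and pairing_scaleR: "pairing f (r *\<^sub>R x) = r *\<^sub>R pairing f x"
  using pairing_bounded_clinear[of f]
  by (auto simp: bounded_clinear_def scaleC_complex_def linear_simps)

setup_lifting type_definition_dual

instantiation dual :: (complex_normed_vector) complex_normed_vector
begin

lift_definition zero_dual :: "'a dual" is 0
  by (simp add: bounded_clinear_def zero_blinfun.rep_eq)

lift_definition plus_dual :: "'a dual \<Rightarrow> 'a dual \<Rightarrow> 'a dual" is "(+)"
  by (auto simp: bounded_clinear_def plus_blinfun.rep_eq scaleC_complex_def algebra_simps
      intro: bounded_linear_add)

lift_definition minus_dual :: "'a dual \<Rightarrow> 'a dual \<Rightarrow> 'a dual" is "(-)"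
  by (auto simp: bounded_clinear_def minus_blinfun.rep_eq scaleC_complex_def algebra_simps
      intro: bounded_linear_sub)

lift_definition uminus_dual :: "'a dual \<Rightarrow> 'a dual" is uminus
  by (auto simp: bounded_clinear_def uminus_blinfun.rep_eq scaleC_complex_def
      intro: bounded_linear_minus)

lift_definition scaleR_dual :: "real \<Rightarrow> 'a dual \<Rightarrow> 'a dual" is "(*\<^sub>R)"
  by (auto simp: bounded_clinear_def scaleR_blinfun.rep_eq scaleC_complex_def
      intro: bounded_linear_const_scaleR)

lift_definition scaleC_dual :: "complex \<Rightarrow> 'a dual \<Rightarrow> 'a dual"
  is "\<lambda>c f. blinfun_mult_right c o\<^sub>L f"
  by (auto simp: bounded_clinear_def scaleC_complex_def blinfun.bounded_linear_right
      intro: bounded_linear_const_mult)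

lift_definition norm_dual :: "'a dual \<Rightarrow> real" is norm .

definition dist_dual :: "'a dual \<Rightarrow> 'a dual \<Rightarrow> real"
  where "dist_dual f g = norm (f - g)"

definition sgn_dual :: "'a dual \<Rightarrow> 'a dual"
  where "sgn_dual f = inverse (norm f) *\<^sub>R f"

definition uniformity_dual :: "('a dual \<times> 'a dual) filter"
  where "uniformity_dual = (INF e\<in>{0<..}. principal {(f, g). dist f g < e})"

definition open_dual :: "'a dual set \<Rightarrow> bool"
  where "open_dual S = (\<forall>f\<in>S. \<forall>\<^sub>F (f', g) in uniformity. f' = f \<longrightarrow> g \<in> S)"

instance
proof
  fix f :: "'a dual" and c :: complex
  show "norm (c *\<^sub>C f) = norm c * norm f"
  proof transfer
    fix c :: complex and f :: "'a \<Rightarrow>\<^sub>L complex"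
    have le: "norm (blinfun_mult_right c o\<^sub>L f) \<le> norm c * norm f"
      for c and f :: "'a \<Rightarrow>\<^sub>L complex"
      by (rule norm_blinfun_bound) (auto simp: norm_mult mult.assoc intro!: mult_left_mono norm_blinfun)
    show "norm (blinfun_mult_right c o\<^sub>L f) = norm c * norm f"
    proof (cases "c = 0")
      case True
      then have "blinfun_mult_right c o\<^sub>L f = 0" by (intro blinfun_eqI) simp
      then show ?thesis using True by simp
    next
      case False
      have "f = blinfun_mult_right (inverse c) o\<^sub>L (blinfun_mult_right c o\<^sub>L f)"
        using False by (intro blinfun_eqI) (simp add: field_simps)
      then have "norm f \<le> norm (inverse c) * norm (blinfun_mult_right c o\<^sub>L f)"
        by (metis le)
      then have "norm c * norm f \<le>
          norm c * (norm (inverse c) * norm (blinfun_mult_right c o\<^sub>L f))"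
        by (rule mult_left_mono) simp
      also have "\<dots> = norm (blinfun_mult_right c o\<^sub>L f)"
        using False by (simp add: norm_inverse)
      finally have "norm c * norm f \<le> norm (blinfun_mult_right c o\<^sub>L f)" .
      then show ?thesis using le[of c f] by linarith
    qed
  qed
next
  fix f g :: "'a dual" and c d :: complex and r :: real
  show "c *\<^sub>C (f + g) = c *\<^sub>C f + c *\<^sub>C g"
    by transfer (auto intro!: blinfun_eqI simp: blinfun.bilinear_simps algebra_simps)
  show "(c + d) *\<^sub>C f = c *\<^sub>C f + d *\<^sub>C f"
    by transfer (auto intro!: blinfun_eqI simp: blinfun.bilinear_simps algebra_simps)
  show "c *\<^sub>C (d *\<^sub>C f) = (c * d) *\<^sub>C f"
    by transfer (auto intro!: blinfun_eqI simp: blinfun.bilinear_simps algebra_simps)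
  show "r *\<^sub>R f = complex_of_real r *\<^sub>C f"
    by transfer
      (auto intro!: blinfun_eqI simp: blinfun.bilinear_simps scaleR_conv_of_real)
  show "norm (f + g) \<le> norm f + norm g"
    by transfer (rule norm_triangle_ineq)
  show "norm (r *\<^sub>R f) = \<bar>r\<bar> * norm f"
    by transfer simp
  show "norm f = 0 \<longleftrightarrow> f = 0"
    by transfer simp
  show "dist f g = norm (f - g)" "sgn f = inverse (norm f) *\<^sub>R f"
    by (rule dist_dual_def sgn_dual_def)+
next
  fix f g h :: "'a dual" and a b :: real
  show "f + g + h = f + (g + h)" by transfer (rule add.assoc)
  show "f + g = g + f" by transfer (rule add.commute)
  show "0 + f = f" by transfer (rule add_0)
  show "- f + f = 0" by transfer (rule left_minus)
  show "f - g = f + - g" by transfer (rule diff_conv_add_uminus)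
  show "a *\<^sub>R (f + g) = a *\<^sub>R f + a *\<^sub>R g" by transfer (rule scaleR_add_right)
  show "(a + b) *\<^sub>R f = a *\<^sub>R f + b *\<^sub>R f" by transfer (rule scaleR_add_left)
  show "a *\<^sub>R b *\<^sub>R f = (a * b) *\<^sub>R f" by transfer (rule scaleR_scaleR)
  show "1 *\<^sub>R f = f" by transfer (rule scaleR_one)
qed (rule uniformity_dual_def open_dual_def)+

end

lemma pairing_eq_apply [simp]:
  shows pairing_plus_dual: "pairing (f + g) x = pairing f x + pairing g x"
    and pairing_minus_dual: "pairing (f - g) x = pairing f x - pairing g x"
    and pairing_zero_dual: "pairing 0 x = 0"
    and pairing_scaleC_dual: "pairing (c *\<^sub>C f) x = c * pairing f x"
    and pairing_scaleR_dual: "pairing (r *\<^sub>R f) x = r *\<^sub>R pairing f x"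
  by (simp_all add: pairing_def plus_dual.rep_eq minus_dual.rep_eq zero_dual.rep_eq
      scaleC_dual.rep_eq scaleR_dual.rep_eq blinfun.bilinear_simps)

lemma norm_pairing: "norm (pairing f x) \<le> norm f * norm x"
  by (simp add: pairing_def norm_dual.rep_eq norm_blinfun)

lemma norm_dual_bound: "0 \<le> b \<Longrightarrow> (\<And>x. norm (pairing f x) \<le> b * norm x) \<Longrightarrow> norm f \<le> b"
  unfolding pairing_def norm_dual.rep_eq by (rule norm_blinfun_bound)

instance dual :: (complex_normed_vector) complex_banach
proof
  fix X :: "nat \<Rightarrow> 'a dual"
  assume X: "Cauchy X"
  have d: "dist (Rep_dual f) (Rep_dual g) = dist f g" for f g :: "'a dual"
    by (simp add: dist_norm norm_dual.rep_eq minus_dual.rep_eq)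
  have "Cauchy (\<lambda>n. Rep_dual (X n))"
    using X by (simp add: Cauchy_def d)
  then obtain L where L: "(\<lambda>n. Rep_dual (X n)) \<longlonglongrightarrow> L"
    using Cauchy_convergent_iff convergent_def by blast
  have lim: "(\<lambda>n. pairing (X n) x) \<longlonglongrightarrow> blinfun_apply L x" for x
    unfolding pairing_def by (intro tendsto_intros L)
  have "blinfun_apply L (c *\<^sub>C x) = c * blinfun_apply L x" for c x
    using lim[of "c *\<^sub>C x"] tendsto_mult_left[OF lim[of x], of c]
    by (simp add: pairing_scaleC LIMSEQ_unique)
  then have "bounded_clinear (blinfun_apply L)"
    by (simp add: bounded_clinear_def scaleC_complex_def blinfun.bounded_linear_right)
  then have "Rep_dual (Abs_dual L) = L"
    by (simp add: Abs_dual_inverse)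
  then have "X \<longlonglongrightarrow> Abs_dual L"
    using L by (simp add: tendsto_iff flip: d)
  then show "convergent X"
    by (auto simp: convergent_def)
qed

text \<open>The multiplication of the acting algebra is a parameter, because the multiplication of the
  amalgamated duplication depends on the module actions and so cannot be given by a type class.
  The actions are jointly continuous, with no restriction on the bound.\<close>

definition banach_bimodule ::
    "('c :: complex_banach \<Rightarrow> 'c \<Rightarrow> 'c) \<Rightarrow> ('c \<Rightarrow> 'x :: complex_banach \<Rightarrow> 'x) \<Rightarrow> ('x \<Rightarrow> 'c \<Rightarrow> 'x) \<Rightarrow> bool"
  where "banach_bimodule m l r \<longleftrightarrow>
    bounded_cbilinear l \<and> bounded_cbilinear r \<and>
    (\<forall>c d x. l (m c d) x = l c (l d x)) \<and>
    (\<forall>c d x. r x (m c d) = r (r x c) d) \<and>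
    (\<forall>c d x. r (l c x) d = l c (r x d))"

definition dual_left :: "('x :: complex_normed_vector \<Rightarrow> 'c \<Rightarrow> 'x) \<Rightarrow> 'c \<Rightarrow> 'x dual \<Rightarrow> 'x dual"
  where "dual_left r c f = dual_of (\<lambda>x. pairing f (r x c))"

definition dual_right :: "('c \<Rightarrow> 'x :: complex_normed_vector \<Rightarrow> 'x) \<Rightarrow> 'x dual \<Rightarrow> 'c \<Rightarrow> 'x dual"
  where "dual_right l f c = dual_of (\<lambda>x. pairing f (l c x))"

definition ad :: "('c \<Rightarrow> 'x \<Rightarrow> 'x) \<Rightarrow> ('x \<Rightarrow> 'c \<Rightarrow> 'x) \<Rightarrow> 'x \<Rightarrow> 'c \<Rightarrow> 'x :: ab_group_add"
  where "ad l r x c = l c x - r x c"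

definition derivation ::
    "('c :: complex_banach \<Rightarrow> 'c \<Rightarrow> 'c) \<Rightarrow> ('c \<Rightarrow> 'x :: complex_banach \<Rightarrow> 'x) \<Rightarrow> ('x \<Rightarrow> 'c \<Rightarrow> 'x) \<Rightarrow>
      ('c \<Rightarrow> 'x) \<Rightarrow> bool"
  where "derivation m l r D \<longleftrightarrow>
    bounded_clinear D \<and> (\<forall>c d. D (m c d) = r (D c) d + l c (D d))"

definition cyclic_derivation ::
    "('c :: complex_banach \<Rightarrow> 'c \<Rightarrow> 'c) \<Rightarrow> ('c \<Rightarrow> 'c dual) \<Rightarrow> bool"
  where "cyclic_derivation m D \<longleftrightarrow>
    derivation m (dual_left m) (dual_right m) D \<and>
    (\<forall>c d. pairing (D c) d + pairing (D d) c = 0)"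

lemma bounded_clinear_compose:
  "bounded_clinear f \<Longrightarrow> bounded_clinear g \<Longrightarrow> bounded_clinear (\<lambda>x. f (g x))"
  by (auto simp: bounded_clinear_def bounded_linear_compose)

lemma pairing_dual_left:
  "bounded_cbilinear r \<Longrightarrow> pairing (dual_left r c f) x = pairing f (r x c)"
  unfolding dual_left_def
  by (subst pairing_dual_of)
    (auto intro: bounded_clinear_compose pairing_bounded_clinear bounded_cbilinear_left)

lemma pairing_dual_right:
  "bounded_cbilinear l \<Longrightarrow> pairing (dual_right l f c) x = pairing f (l c x)"
  unfolding dual_right_def
  by (subst pairing_dual_of)
    (auto intro: bounded_clinear_compose pairing_bounded_clinear bounded_cbilinear_right)

lemma banach_bimodule_dual:
  assumes "banach_bimodule m l r"
  shows "banach_bimodule m (dual_left r) (dual_right l)"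
proof -
  have l: "bounded_cbilinear l" and r: "bounded_cbilinear r"
    using assms by (auto simp: banach_bimodule_def)
  interpret l: bounded_bilinear l using l by (simp add: bounded_cbilinear_def)
  interpret r: bounded_bilinear r using r by (simp add: bounded_cbilinear_def)
  note [simp] = pairing_dual_left[OF r] pairing_dual_right[OF l]
  have lC: "l (k *\<^sub>C c) x = k *\<^sub>C l c x" for k c x using l by (simp add: bounded_cbilinear_def)
  have rC: "r x (k *\<^sub>C c) = k *\<^sub>C r x c" for k c x using r by (simp add: bounded_cbilinear_def)
  have "bounded_bilinear (dual_left r)"
  proof
    obtain K where K: "0 \<le> K" "norm (r x c) \<le> norm x * norm c * K" for x c
      using r.nonneg_bounded by blast
    have "norm (dual_left r c f) \<le> norm c * norm f * K" for c f
    proof (rule norm_dual_bound)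
      fix x
      have "norm (pairing f (r x c)) \<le> norm f * norm (r x c)" by (rule norm_pairing)
      also have "\<dots> \<le> norm f * (norm x * norm c * K)" by (intro mult_left_mono K) simp
      finally show "norm (pairing (dual_left r c f) x) \<le> norm c * norm f * K * norm x"
        by (simp add: mult_ac)
    qed (use K in simp)
    then show "\<exists>K. \<forall>c f. norm (dual_left r c f) \<le> norm c * norm f * K" by blast
  qed (auto intro!: dual_eqI simp: r.add_right r.scaleR_right pairing_add pairing_scaleR)
  moreover have "bounded_bilinear (dual_right l)"
  proof
    obtain K where K: "0 \<le> K" "norm (l c x) \<le> norm c * norm x * K" for x c
      using l.nonneg_bounded by blast
    have "norm (dual_right l f c) \<le> norm f * norm c * K" for c f
    proof (rule norm_dual_bound)
      fix x
      have "norm (pairing f (l c x)) \<le> norm f * norm (l c x)" by (rule norm_pairing)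
      also have "\<dots> \<le> norm f * (norm c * norm x * K)" by (intro mult_left_mono K) simp
      finally show "norm (pairing (dual_right l f c) x) \<le> norm f * norm c * K * norm x"
        by (simp add: mult_ac)
    qed (use K in simp)
    then show "\<exists>K. \<forall>f c. norm (dual_right l f c) \<le> norm f * norm c * K" by blast
  qed (auto intro!: dual_eqI simp: l.add_left l.scaleR_left pairing_add pairing_scaleR)
  ultimately show ?thesis
    using assms unfolding banach_bimodule_def bounded_cbilinear_def
    by (auto intro!: dual_eqI simp: lC rC pairing_scaleC)
qed

text \<open>The product type of the library carries the Euclidean norm, so the duplication gets a type
  of its own with the sum norm.\<close>

datatype ('a, 'b) amalg = Amalg (amalg_fst: 'a) (amalg_snd: 'b)

instantiation amalg :: (complex_normed_vector, complex_normed_vector) complex_normed_vector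
begin

definition "0 = Amalg 0 0"
definition "z + w = Amalg (amalg_fst z + amalg_fst w) (amalg_snd z + amalg_snd w)"
definition "z - w = Amalg (amalg_fst z - amalg_fst w) (amalg_snd z - amalg_snd w)"
definition "- z = Amalg (- amalg_fst z) (- amalg_snd z)"
definition "r *\<^sub>R z = Amalg (r *\<^sub>R amalg_fst z) (r *\<^sub>R amalg_snd z)"
definition "c *\<^sub>C z = Amalg (c *\<^sub>C amalg_fst z) (c *\<^sub>C amalg_snd z)"
definition "norm z = norm (amalg_fst z) + norm (amalg_snd z)"
definition "dist z w = norm (z - w :: ('a, 'b) amalg)"
definition "sgn z = inverse (norm z) *\<^sub>R (z :: ('a, 'b) amalg)"
definition uniformity_amalg :: "(('a, 'b) amalg \<times> ('a, 'b) amalg) filter"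
  where "uniformity_amalg = (INF e\<in>{0<..}. principal {(z, w). dist z w < e})"
definition open_amalg :: "('a, 'b) amalg set \<Rightarrow> bool"
  where "open_amalg S = (\<forall>z\<in>S. \<forall>\<^sub>F (z', w) in uniformity. z' = z \<longrightarrow> w \<in> S)"

instance
proof
  fix z w :: "('a, 'b) amalg"
  show "norm (z + w) \<le> norm z + norm w"
    unfolding norm_amalg_def plus_amalg_def
    using norm_triangle_ineq[of "amalg_fst z" "amalg_fst w"] norm_triangle_ineq[of "amalg_snd z" "amalg_snd w"] by simp
next
  fix z :: "('a, 'b) amalg" and c d :: complex and r :: real
  show "norm z = 0 \<longleftrightarrow> z = 0"
    by (cases z) (simp add: norm_amalg_def zero_amalg_def add_nonneg_eq_0_iff)
  show "norm (r *\<^sub>R z) = \<bar>r\<bar> * norm z"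
    by (simp add: norm_amalg_def scaleR_amalg_def distrib_left)
  show "norm (c *\<^sub>C z) = norm c * norm z"
    by (simp add: norm_amalg_def scaleC_amalg_def norm_scaleC distrib_left)
  show "r *\<^sub>R z = complex_of_real r *\<^sub>C z"
    by (simp add: scaleR_amalg_def scaleC_amalg_def scaleR_scaleC)
  show "c *\<^sub>C (d *\<^sub>C z) = (c * d) *\<^sub>C z"
    by (simp add: scaleC_amalg_def scaleC_scaleC)
qed (simp_all add: dist_amalg_def sgn_amalg_def uniformity_amalg_def open_amalg_def zero_amalg_def
    plus_amalg_def minus_amalg_def uminus_amalg_def scaleR_amalg_def scaleC_amalg_def add.assoc
    add.commute scaleR_add_right scaleR_add_left scaleC_add_right scaleC_add_left)

end

lemma amalg_sel [simp]:
  "amalg_fst 0 = 0" "amalg_snd 0 = 0"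
  "amalg_fst (z + w) = amalg_fst z + amalg_fst w" "amalg_snd (z + w) = amalg_snd z + amalg_snd w"
  "amalg_fst (z - w) = amalg_fst z - amalg_fst w" "amalg_snd (z - w) = amalg_snd z - amalg_snd w"
  "amalg_fst (r *\<^sub>R z) = r *\<^sub>R amalg_fst z" "amalg_snd (r *\<^sub>R z) = r *\<^sub>R amalg_snd z"
  "amalg_fst (c *\<^sub>C z) = c *\<^sub>C amalg_fst z" "amalg_snd (c *\<^sub>C z) = c *\<^sub>C amalg_snd z"
  by (simp_all add: zero_amalg_def plus_amalg_def minus_amalg_def scaleR_amalg_def scaleC_amalg_def)

lemma bounded_clinear_amalg_fst: "bounded_clinear amalg_fst"
  unfolding bounded_clinear_def
  by (auto intro!: bounded_linear_intro[where K = 1] simp: norm_amalg_def)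

lemma bounded_clinear_amalg_snd: "bounded_clinear amalg_snd"
  unfolding bounded_clinear_def
  by (auto intro!: bounded_linear_intro[where K = 1] simp: norm_amalg_def)

lemma bounded_clinear_Amalg_left: "bounded_clinear (\<lambda>a. Amalg a 0)"
  unfolding bounded_clinear_def
  by (auto intro!: bounded_linear_intro[where K = 1] simp: norm_amalg_def amalg.expand)

lemma bounded_clinear_Amalg_right: "bounded_clinear (\<lambda>b. Amalg 0 b)"
  unfolding bounded_clinear_def
  by (auto intro!: bounded_linear_intro[where K = 1] simp: norm_amalg_def amalg.expand)

instance amalg :: (complex_banach, complex_banach) complex_banach
proof
  fix X :: "nat \<Rightarrow> ('a, 'b) amalg"
  assume X: "Cauchy X"
  have "Cauchy (\<lambda>n. amalg_fst (X n))" "Cauchy (\<lambda>n. amalg_snd (X n))"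
    using X bounded_linear.Cauchy bounded_clinear_amalg_fst bounded_clinear_amalg_snd
    by (auto simp: bounded_clinear_def)
  then obtain a b where a: "(\<lambda>n. amalg_fst (X n)) \<longlonglongrightarrow> a" and b: "(\<lambda>n. amalg_snd (X n)) \<longlonglongrightarrow> b"
    using Cauchy_convergent_iff convergent_def by metis
  have "(\<lambda>n. norm (amalg_fst (X n) - a) + norm (amalg_snd (X n) - b)) \<longlonglongrightarrow> 0"
    using tendsto_add[OF tendsto_norm_zero[OF LIM_zero[OF a]] tendsto_norm_zero[OF LIM_zero[OF b]]]
    by simp
  then have "(\<lambda>n. norm (X n - Amalg a b)) \<longlonglongrightarrow> 0"
    by (simp add: norm_amalg_def)
  then show "convergent X"
    by (blast intro: convergentI LIM_zero_cancel[OF tendsto_norm_zero_cancel])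
qed

definition compatible_actions ::
    "('u \<Rightarrow> 'a :: complex_banach_algebra \<Rightarrow> 'a) \<Rightarrow> ('a \<Rightarrow> 'u \<Rightarrow> 'a) \<Rightarrow> bool"
  where "compatible_actions l r \<longleftrightarrow>
    (\<forall>a b \<beta>. l \<beta> (a * b) = l \<beta> a * b \<and> r (a * b) \<beta> = a * r b \<beta> \<and> a * l \<beta> b = r a \<beta> * b)"

definition amalg_mult ::
    "('u :: complex_banach_algebra \<Rightarrow> 'a :: complex_banach_algebra \<Rightarrow> 'a) \<Rightarrow> ('a \<Rightarrow> 'u \<Rightarrow> 'a) \<Rightarrow>
      ('a, 'u) amalg \<Rightarrow> ('a, 'u) amalg \<Rightarrow> ('a, 'u) amalg"
  where "amalg_mult l r z w =
    Amalg (amalg_fst z * amalg_fst w + r (amalg_fst z) (amalg_snd w) + l (amalg_snd z) (amalg_fst w)) (amalg_snd z * amalg_snd w)"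

definition dual_pair ::
    "'a :: complex_normed_vector dual \<Rightarrow> 'b :: complex_normed_vector dual \<Rightarrow> ('a, 'b) amalg dual"
  where "dual_pair f g = dual_of (\<lambda>z. pairing f (amalg_fst z) + pairing g (amalg_snd z))"

text \<open>\<open>dual_tri l a x\<close> and \<open>dual_bullet r x a\<close> are the functionals \<open>a \<blacktriangle> x\<close> and \<open>x \<bullet> a\<close>.\<close>

definition dual_tri ::
    "('u :: complex_normed_vector \<Rightarrow> 'a :: complex_normed_vector \<Rightarrow> 'a) \<Rightarrow> 'a \<Rightarrow> 'a dual \<Rightarrow> 'u dual"
  where "dual_tri l a x = dual_of (\<lambda>\<gamma>. pairing x (l \<gamma> a))"

definition dual_bullet ::
    "('a :: complex_normed_vector \<Rightarrow> 'u :: complex_normed_vector \<Rightarrow> 'a) \<Rightarrow> 'a dual \<Rightarrow> 'a \<Rightarrow> 'u dual"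
  where "dual_bullet r x a = dual_of (\<lambda>\<gamma>. pairing x (r a \<gamma>))"

lemma pairing_dual_tri: "bounded_cbilinear l \<Longrightarrow> pairing (dual_tri l a x) \<gamma> = pairing x (l \<gamma> a)"
  unfolding dual_tri_def
  by (subst pairing_dual_of)
    (auto intro: bounded_clinear_compose pairing_bounded_clinear bounded_cbilinear_left)

lemma pairing_dual_bullet:
  "bounded_cbilinear r \<Longrightarrow> pairing (dual_bullet r x a) \<gamma> = pairing x (r a \<gamma>)"
  unfolding dual_bullet_def
  by (subst pairing_dual_of)
    (auto intro: bounded_clinear_compose pairing_bounded_clinear bounded_cbilinear_right)

lemma bounded_clinear_add:
  "bounded_clinear f \<Longrightarrow> bounded_clinear g \<Longrightarrow> bounded_clinear (\<lambda>x. f x + g x)"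
  by (auto simp: bounded_clinear_def bounded_linear_add scaleC_add_right)

lemma pairing_dual_pair: "pairing (dual_pair f g) z = pairing f (amalg_fst z) + pairing g (amalg_snd z)"
  unfolding dual_pair_def
  by (subst pairing_dual_of)
    (auto intro: bounded_clinear_add
      bounded_clinear_compose[OF pairing_bounded_clinear bounded_clinear_amalg_fst]
      bounded_clinear_compose[OF pairing_bounded_clinear bounded_clinear_amalg_snd])

lemma dual_pair_inject: "dual_pair f g = dual_pair f' g' \<longleftrightarrow> f = f' \<and> g = g'"
proof
  assume eq: "dual_pair f g = dual_pair f' g'"
  have "pairing f a + pairing g b = pairing f' a + pairing g' b" for a b
    using arg_cong[OF eq, of "\<lambda>h. pairing h (Amalg a b)"] by (simp add: pairing_dual_pair)
  from this[of _ 0] this[of 0] show "f = f' \<and> g = g'"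
    by (auto intro!: dual_eqI simp: pairing_zero)
qed simp

lemma dual_pair_surj: "\<exists>f g. h = dual_pair f g"
proof (intro exI dual_eqI)
  fix z
  have "pairing h z = pairing h (Amalg (amalg_fst z) 0 + Amalg 0 (amalg_snd z))"
    by (simp add: plus_amalg_def)
  then show "pairing h z = pairing (dual_pair (dual_of (\<lambda>a. pairing h (Amalg a 0)))
      (dual_of (\<lambda>b. pairing h (Amalg 0 b)))) z"
    by (simp add: pairing_add pairing_dual_pair
        pairing_dual_of[OF bounded_clinear_compose[OF pairing_bounded_clinear
          bounded_clinear_Amalg_left]]
        pairing_dual_of[OF bounded_clinear_compose[OF pairing_bounded_clinear
          bounded_clinear_Amalg_right]])
qed

lemma amalg_mult_assoc:
  assumes "banach_bimodule (*) l r" "compatible_actions l r"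
  shows "amalg_mult l r (amalg_mult l r z w) v = amalg_mult l r z (amalg_mult l r w v)"
proof -
  interpret l: bounded_bilinear l
    using assms by (simp add: banach_bimodule_def bounded_cbilinear_def)
  interpret r: bounded_bilinear r
    using assms by (simp add: banach_bimodule_def bounded_cbilinear_def)
  have 1: "l (c * d) x = l c (l d x)" "r x (c * d) = r (r x c) d" "r (l c x) d = l c (r x d)"
    for c d x using assms by (auto simp: banach_bimodule_def)
  have 2: "l c (a * b) = l c a * b" "r (a * b) c = a * r b c" "a * l c b = r a c * b"
    for a b c using assms unfolding compatible_actions_def by blast+
  show ?thesis
    by (simp add: amalg_mult_def l.add_right r.add_left 1 2 distrib_left distrib_right mult.assoc
        add_ac)
qed

lemma bounded_cbilinear_amalg_mult:
  assumes "bounded_cbilinear l" "bounded_cbilinear r"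
  shows "bounded_cbilinear (amalg_mult l r)"
proof -
  interpret l: bounded_bilinear l using assms by (simp add: bounded_cbilinear_def)
  interpret r: bounded_bilinear r using assms by (simp add: bounded_cbilinear_def)
  obtain K where K: "0 \<le> K" "norm (l c x) \<le> norm c * norm x * K" for x c
    using l.nonneg_bounded by blast
  obtain L where L: "0 \<le> L" "norm (r x c) \<le> norm x * norm c * L" for x c
    using r.nonneg_bounded by blast
  have "norm (amalg_mult l r z w) \<le> norm z * norm w * (2 + K + L)" for z w
  proof -
    have n: "norm (amalg_fst v) \<le> norm v" "norm (amalg_snd v) \<le> norm v" for v :: "('b, 'a) amalg"
      by (simp_all add: norm_amalg_def)
    have "norm (amalg_mult l r z w) \<le> norm (amalg_fst z * amalg_fst w) + norm (r (amalg_fst z) (amalg_snd w)) +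
        norm (l (amalg_snd z) (amalg_fst w)) + norm (amalg_snd z * amalg_snd w)"
      by (simp add: norm_amalg_def amalg_mult_def norm_triangle_le add_mono norm_triangle_ineq)
    also have "\<dots> \<le> norm z * norm w + norm z * norm w * L + norm z * norm w * K + norm z * norm w"
    proof (intro add_mono)
      show "norm (amalg_fst z * amalg_fst w) \<le> norm z * norm w"
        by (rule order_trans[OF norm_mult_ineq]) (intro mult_mono n norm_ge_zero)
      show "norm (amalg_snd z * amalg_snd w) \<le> norm z * norm w"
        by (rule order_trans[OF norm_mult_ineq]) (intro mult_mono n norm_ge_zero)
      show "norm (r (amalg_fst z) (amalg_snd w)) \<le> norm z * norm w * L"
        by (rule order_trans[OF L(2)])
          (intro mult_mono mult_right_mono n norm_ge_zero L mult_nonneg_nonneg order_refl)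
      show "norm (l (amalg_snd z) (amalg_fst w)) \<le> norm z * norm w * K"
        by (rule order_trans[OF K(2)])
          (intro mult_mono mult_right_mono n norm_ge_zero K mult_nonneg_nonneg order_refl)
    qed
    finally show ?thesis by (simp add: algebra_simps)
  qed
  then have "\<exists>M. \<forall>z w. norm (amalg_mult l r z w) \<le> norm z * norm w * M" by blast
  moreover have "amalg_mult l r (z + z') w = amalg_mult l r z w + amalg_mult l r z' w"
    "amalg_mult l r z (w + w') = amalg_mult l r z w + amalg_mult l r z w'"
    "amalg_mult l r (t *\<^sub>R z) w = t *\<^sub>R amalg_mult l r z w"
    "amalg_mult l r z (t *\<^sub>R w) = t *\<^sub>R amalg_mult l r z w" for z z' w w' t
    by (simp_all add: amalg_mult_def plus_amalg_def scaleR_amalg_def l.add_left l.add_right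
        r.add_left r.add_right l.scaleR_left l.scaleR_right r.scaleR_left r.scaleR_right
        distrib_left distrib_right scaleR_add_right add_ac)
  ultimately have "bounded_bilinear (amalg_mult l r)"
    by (blast intro: bounded_bilinear.intro)
  then show ?thesis
    using assms unfolding bounded_cbilinear_def
    by (simp add: amalg_mult_def scaleC_amalg_def scaleC_add_right mult_scaleC_left
        mult_scaleC_right)
qed

lemma norm_amalg_mult_ineq:
  assumes "\<And>c x. norm (l c x) \<le> norm c * norm x" "\<And>x c. norm (r x c) \<le> norm x * norm c"
  shows "norm (amalg_mult l r z w) \<le> norm z * norm w"
proof -
  have "norm (amalg_mult l r z w) \<le> norm (amalg_fst z * amalg_fst w) + norm (r (amalg_fst z) (amalg_snd w)) +
      norm (l (amalg_snd z) (amalg_fst w)) + norm (amalg_snd z * amalg_snd w)"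
    by (simp add: norm_amalg_def amalg_mult_def norm_triangle_le add_mono norm_triangle_ineq)
  also have "\<dots> \<le> norm (amalg_fst z) * norm (amalg_fst w) + norm (amalg_fst z) * norm (amalg_snd w) +
      norm (amalg_snd z) * norm (amalg_fst w) + norm (amalg_snd z) * norm (amalg_snd w)"
    by (intro add_mono assms norm_mult_ineq)
  finally show ?thesis by (simp add: norm_amalg_def algebra_simps)
qed

lemma banach_bimodule_amalg:
  assumes "banach_bimodule (*) l r" "compatible_actions l r"
  shows "banach_bimodule (amalg_mult l r) (amalg_mult l r) (amalg_mult l r)"
proof -
  have "bounded_cbilinear (amalg_mult l r)"
    using assms(1) unfolding banach_bimodule_def by (blast intro: bounded_cbilinear_amalg_mult)
  then show ?thesis
    unfolding banach_bimodule_def using amalg_mult_assoc[OF assms]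
    by (intro conjI allI) (assumption | simp only:)+
qed

lemma bounded_clinear_restrict:
  fixes e :: "'a :: complex_normed_vector \<Rightarrow> 'b :: complex_normed_vector"
  assumes e: "bounded_clinear e"
  shows "bounded_clinear (\<lambda>h. dual_of (\<lambda>y. pairing h (e y)))"
proof -
  define R where "R h = dual_of (\<lambda>y. pairing h (e y))" for h :: "'b dual"
  have p: "pairing (R h) y = pairing h (e y)" for h y
    unfolding R_def
    by (subst pairing_dual_of) (rule bounded_clinear_compose[OF pairing_bounded_clinear e] refl)+
  obtain K where K: "0 \<le> K" "norm (e y) \<le> norm y * K" for y
    using bounded_linear.nonneg_bounded[of e] e unfolding bounded_clinear_def by metis
  have "norm (R h) \<le> norm h * K" for h
  proof (rule norm_dual_bound)
    fix y
    have "norm (pairing h (e y)) \<le> norm h * norm (e y)" by (rule norm_pairing)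
    also have "\<dots> \<le> norm h * (norm y * K)" by (intro mult_left_mono K) simp
    finally show "norm (pairing (R h) y) \<le> norm h * K * norm y"
      by (simp add: p mult_ac)
  qed (use K in simp)
  moreover have "R (h + k) = R h + R k" "R (t *\<^sub>R h) = t *\<^sub>R R h" "R (c *\<^sub>C h) = c *\<^sub>C R h"
    for h k t c
    by (rule dual_eqI, simp add: p)+
  ultimately have "bounded_clinear R"
    unfolding bounded_clinear_def by (blast intro: bounded_linear_intro)
  then show ?thesis unfolding R_def .
qed

text \<open>Linearity is needed for the component equation to determine the components: it is unchanged
  when a constant is moved from one summand to the other.\<close>

lemma components_exist:
  fixes D :: "('a :: complex_normed_vector, 'b :: complex_normed_vector) amalg \<Rightarrow>
    ('a, 'b) amalg dual"
  assumes D: "bounded_clinear D"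
  shows "\<exists>D1A D2A D1U D2U.
    bounded_clinear D1A \<and> bounded_clinear D2A \<and> bounded_clinear D1U \<and> bounded_clinear D2U \<and>
    (\<forall>a \<beta>. D (Amalg a \<beta>) = dual_pair (D1A a + D1U \<beta>) (D2A a + D2U \<beta>))"
proof -
  define p where "p h = dual_of (\<lambda>a. pairing h (Amalg a 0))" for h :: "('a, 'b) amalg dual"
  define q where "q h = dual_of (\<lambda>b. pairing h (Amalg 0 b))" for h :: "('a, 'b) amalg dual"
  have p: "bounded_clinear p" and q: "bounded_clinear q"
    using bounded_clinear_restrict[OF bounded_clinear_Amalg_left]
      bounded_clinear_restrict[OF bounded_clinear_Amalg_right]
    unfolding p_def q_def .
  have pq: "dual_pair (p h) (q h) = h" for h
  proof -
    obtain f g where h: "h = dual_pair f g" using dual_pair_surj by blast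
    have "pairing (p h) a = pairing h (Amalg a 0)" "pairing (q h) b = pairing h (Amalg 0 b)" for a b
      unfolding p_def q_def
      by (simp_all add:
          pairing_dual_of[OF bounded_clinear_compose[OF pairing_bounded_clinear
            bounded_clinear_Amalg_left]]
          pairing_dual_of[OF bounded_clinear_compose[OF pairing_bounded_clinear
            bounded_clinear_Amalg_right]])
    then have "p h = f" "q h = g"
      by (auto intro!: dual_eqI simp: h pairing_dual_pair pairing_zero)
    then show ?thesis by (simp add: h)
  qed
  have add: "p (h + k) = p h + p k" "q (h + k) = q h + q k" for h k
    using p q by (auto simp: bounded_clinear_def linear_simps)
  have "D (Amalg a \<beta>) = D (Amalg a 0) + D (Amalg 0 \<beta>)" for a \<beta>
    using D linear_simps(1)[of D "Amalg a 0" "Amalg 0 \<beta>"]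
    by (simp add: bounded_clinear_def plus_amalg_def)
  then have "D (Amalg a \<beta>) = dual_pair (p (D (Amalg a 0)) + p (D (Amalg 0 \<beta>)))
      (q (D (Amalg a 0)) + q (D (Amalg 0 \<beta>)))" for a \<beta>
    by (metis add pq)
  then show ?thesis
    using bounded_clinear_compose[OF p bounded_clinear_compose[OF D bounded_clinear_Amalg_left]]
      bounded_clinear_compose[OF q bounded_clinear_compose[OF D bounded_clinear_Amalg_left]]
      bounded_clinear_compose[OF p bounded_clinear_compose[OF D bounded_clinear_Amalg_right]]
      bounded_clinear_compose[OF q bounded_clinear_compose[OF D bounded_clinear_Amalg_right]]
    by blast
qed

lemma components_unique:
  assumes "bounded_clinear f1" "bounded_clinear f2" "bounded_clinear g1" "bounded_clinear g2"
    and "bounded_clinear f1'" "bounded_clinear f2'" "bounded_clinear g1'" "bounded_clinear g2'"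
    and eq: "\<And>a \<beta>. dual_pair (f1 a + g1 \<beta>) (f2 a + g2 \<beta>) = dual_pair (f1' a + g1' \<beta>) (f2' a + g2' \<beta>)"
  shows "f1 = f1'" "f2 = f2'" "g1 = g1'" "g2 = g2'"
proof -
  have z: "f1 0 = 0" "f2 0 = 0" "g1 0 = 0" "g2 0 = 0" "f1' 0 = 0" "f2' 0 = 0" "g1' 0 = 0" "g2' 0 = 0"
    using assms by (auto simp: bounded_clinear_def linear_simps)
  show "f1 = f1'" "f2 = f2'" using eq[of _ 0] by (auto simp: dual_pair_inject z)
  show "g1 = g1'" "g2 = g2'" using eq[of 0] by (auto simp: dual_pair_inject z)
qed

end

theory Submission
  imports Defs
begin

text \<open>
  Pairing the inner derivation of $(x,\xi)$ at $(a,\beta)$ with $(b,\gamma)$ gives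
  $\langle x, ba + b\cdot\beta + \gamma\cdot a\rangle + \langle\xi,\gamma\beta\rangle
   - \langle x, ab + a\cdot\gamma + \beta\cdot b\rangle - \langle\xi,\beta\gamma\rangle$.
  Every term involves just one of $a,\beta$ and just one of $b,\gamma$. Sorting the terms by these
  two variables writes the inner derivation itself in component form
  (\<open>ad_amalg_mult_dual_pair\<close>), and its four components are precisely the maps on the
  right-hand side of the theorem. Components that vanish at 0, as linear ones do, can be
  read off from the restrictions of the map to the two summands
  (\<open>dual_pair_components_eq_iff\<close>), so $D$ and the inner derivation agree
  if and only if their components do.
\<close>

lemma ad_amalg_mult_dual_pair:
  fixes l :: "'u::complex_banach_algebra \<Rightarrow> 'a::complex_banach_algebra \<Rightarrow> 'a"
  assumes l: "bounded_cbilinear l" and r: "bounded_cbilinear r"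
  shows "ad (dual_left (amalg_mult l r)) (dual_right (amalg_mult l r)) (dual_pair x \<xi>) (Amalg a \<beta>) =
    dual_pair (ad (dual_left (*)) (dual_right (*)) x a + ad (dual_left r) (dual_right l) x \<beta>)
      (dual_tri l a x - dual_bullet r x a + ad (dual_left (*)) (dual_right (*)) \<xi> \<beta>)"
  by (rule dual_eqI)
    (simp add: ad_def pairing_dual_pair amalg_mult_def pairing_add algebra_simps
      pairing_dual_left[OF bounded_cbilinear_amalg_mult[OF l r]]
      pairing_dual_right[OF bounded_cbilinear_amalg_mult[OF l r]]
      pairing_dual_left[OF bounded_cbilinear_times] pairing_dual_right[OF bounded_cbilinear_times]
      pairing_dual_left[OF r] pairing_dual_right[OF l]
      pairing_dual_tri[OF l] pairing_dual_bullet[OF r])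

text \<open>Vanishing at 0 fixes how a constant is shared between the two summands of each
  coordinate; evaluating at $(a,0)$ and $(0,\beta)$ then separates them.\<close>

lemma dual_pair_components_eq_iff:
  assumes "f1 0 = 0" "f2 0 = 0" "g1 0 = 0" "g2 0 = 0" "f1' 0 = 0" "f2' 0 = 0" "g1' 0 = 0" "g2' 0 = 0"
  shows "(\<forall>a \<beta>. dual_pair (f1 a + g1 \<beta>) (f2 a + g2 \<beta>) = dual_pair (f1' a + g1' \<beta>) (f2' a + g2' \<beta>))
    \<longleftrightarrow> f1 = f1' \<and> f2 = f2' \<and> g1 = g1' \<and> g2 = g2'"
    (is "?eq \<longleftrightarrow> ?comps")
proof
  assume eq: ?eq
  have "f1 a = f1' a \<and> f2 a = f2' a" for a
    using eq[rule_format, of a 0] by (simp add: dual_pair_inject assms)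
  moreover have "g1 \<beta> = g1' \<beta> \<and> g2 \<beta> = g2' \<beta>" for \<beta>
    using eq[rule_format, of 0 \<beta>] by (simp add: dual_pair_inject assms)
  ultimately show ?comps by blast
qed simp

lemma bounded_cbilinear_zero:
  assumes "bounded_cbilinear p"
  shows "p 0 y = 0" "p x 0 = 0"
  using assms by (auto simp: bounded_cbilinear_def bounded_bilinear.zero_left
      bounded_bilinear.zero_right)

lemma ad_dual_zero:
  assumes "bounded_cbilinear l" "bounded_cbilinear r"
  shows "ad (dual_left r) (dual_right l) f 0 = 0"
  by (rule dual_eqI)
    (simp add: ad_def pairing_dual_left pairing_dual_right bounded_cbilinear_zero pairing_zero assms)

lemma dual_tri_minus_bullet_zero:
  assumes "bounded_cbilinear l" "bounded_cbilinear r"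
  shows "dual_tri l 0 f - dual_bullet r f 0 = 0"
  by (rule dual_eqI)
    (simp add: pairing_dual_tri pairing_dual_bullet bounded_cbilinear_zero pairing_zero assms)

theorem proposition4p5:
  fixes l :: "'u::complex_banach_algebra \<Rightarrow> 'a::complex_banach_algebra \<Rightarrow> 'a"
    and r :: "'a \<Rightarrow> 'u \<Rightarrow> 'a"
    and D :: "('a, 'u) amalg \<Rightarrow> ('a, 'u) amalg dual"
    and D1A :: "'a \<Rightarrow> 'a dual" and D2A :: "'a \<Rightarrow> 'u dual"
    and D1U :: "'u \<Rightarrow> 'a dual" and D2U :: "'u \<Rightarrow> 'u dual"
    and x :: "'a dual" and \<xi> :: "'u dual"
  assumes "banach_bimodule (*) l r"
    and "compatible_actions l r"
    and "cyclic_derivation (amalg_mult l r) D"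
    and "bounded_clinear D1A" "bounded_clinear D2A" "bounded_clinear D1U" "bounded_clinear D2U"
    and "\<And>a \<beta>. D (Amalg a \<beta>) = dual_pair (D1A a + D1U \<beta>) (D2A a + D2U \<beta>)"
  shows "D = ad (dual_left (amalg_mult l r)) (dual_right (amalg_mult l r)) (dual_pair x \<xi>) \<longleftrightarrow>
    D1A = ad (dual_left (*)) (dual_right (*)) x \<and>
    D2U = ad (dual_left (*)) (dual_right (*)) \<xi> \<and>
    D1U = ad (dual_left r) (dual_right l) x \<and>
    (\<forall>a. D2A a = dual_tri l a x - dual_bullet r x a)"
proof -
  have l: "bounded_cbilinear l" and r: "bounded_cbilinear r"
    using assms(1) by (auto simp: banach_bimodule_def)
  have D0: "D1A 0 = 0" "D2A 0 = 0" "D1U 0 = 0" "D2U 0 = 0"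
    using assms(4-7) by (auto simp: bounded_clinear_def linear_simps)
  define E where "E = ad (dual_left (amalg_mult l r)) (dual_right (amalg_mult l r)) (dual_pair x \<xi>)"
  have "D = E \<longleftrightarrow> (\<forall>a \<beta>. D (Amalg a \<beta>) = E (Amalg a \<beta>))"
    by (metis amalg.exhaust ext)
  also have "\<dots> \<longleftrightarrow> D1A = ad (dual_left (*)) (dual_right (*)) x \<and>
      D2A = (\<lambda>a. dual_tri l a x - dual_bullet r x a) \<and>
      D1U = ad (dual_left r) (dual_right l) x \<and>
      D2U = ad (dual_left (*)) (dual_right (*)) \<xi>"
    unfolding E_def assms(8) ad_amalg_mult_dual_pair[OF l r]
    by (rule dual_pair_components_eq_iff)
      (simp_all add: D0 ad_dual_zero dual_tri_minus_bullet_zero bounded_cbilinear_times l r)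
  finally show ?thesis
    unfolding E_def by (auto simp: fun_eq_iff)
qed

end
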